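(* Let $\xi>0$ and let $C=\{x\in\mathbb R^n\mid\|x\|_2\le\xi\}$ be the Euclidean ball. Let $\gamma\in\mathbb R$, $h\in\mathbb R^n$, $Q_0>0$, $Q(z):=\frac12\|z\|_2^2+Q_0$, $E_{\gamma,h}(x):=-\frac{\gamma+\langle h,x\rangle}{Q(x)}$, and assume $\sup_{x\in C}E_{\gamma,h}(x)>0$. Then $$P_C(y)=\begin{cases}\xi y/\|y\|_2,&\|y\|_2>\xi,\\ y,&\|y\|_2\le\xi.\end{cases}$$ Moreover, let $$e=\frac{-\beta_2+\sqrt{\beta_2^2-4\beta_1\beta_3}}{2\beta_1},\qquad \beta_1:=Q_0,\quad\beta_2:=\gamma,\quad\beta_3:=-\tfrac12\|h\|_2^2 .$$ If $\|e^{-1}h\|_2\le\xi$ for this $e$, then the problem $\sup_{x\in C}E_{\gamma,h}(x)$ is solved by $u=-e^{-1}h$, with optimal value $e$; otherwise, the solution $u$ and the optimal value $e$ of this problem are given by $$u=-\frac{\xi}{\|h\|_2}h,\qquad e=-\frac{2(\gamma-\xi\|h\|_2)}{\xi^2+2Q_0}.$$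
   Context: $P_C(y):=\operatorname{argmin}_{x\in C}\frac12\|x-y\|_2^2$ denotes the orthogonal projection onto $C$; $\|\cdot\|_2$ is the Euclidean norm and $\langle\cdot,\cdot\rangle$ the standard inner product on $\mathbb R^n$. "The problem is solved by $u$" means that $u\in C$ is a maximizer of $E_{\gamma,h}$ over $C$; the optimal value is $E_{\gamma,h}(u)$. *)

theory Defs
  imports "HOL-Analysis.Analysis"
begin

text \<open>Set-valued argmin: a formula for the projection is stated as equality with a singleton,
  which asserts that the minimizer exists and is unique.\<close>
definition orth_proj :: "(real ^ 'n) set \<Rightarrow> real ^ 'n \<Rightarrow> (real ^ 'n) set"
  where "orth_proj C y = {x. is_arg_min (\<lambda>x. 1/2 * (norm (x - y))\<^sup>2) (\<lambda>x. x \<in> C) x}"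

definition quad :: "real \<Rightarrow> real ^ 'n \<Rightarrow> real"
  where "quad Q0 z = 1/2 * (norm z)\<^sup>2 + Q0"

definition obj :: "real \<Rightarrow> real \<Rightarrow> real ^ 'n \<Rightarrow> real ^ 'n \<Rightarrow> real"
  where "obj Q0 \<gamma> h x = - ((\<gamma> + h \<bullet> x) / quad Q0 x)"

definition solutions :: "('a \<Rightarrow> real) \<Rightarrow> 'a set \<Rightarrow> 'a set"
  where "solutions f C = {u. is_arg_max f (\<lambda>x. x \<in> C) u}"

end

theory Submission imports Defs begin

text \<open>
  The ratio problem is reduced to a projection by Dinkelbach's idea. If \<open>t > 0\<close> is a value of the
  objective, comparing the objective at \<open>x\<close> with \<open>t\<close> means finding the sign of
  \<open>t Q(x) + \<gamma> + \<langle>h, x\<rangle>\<close>. Because \<open>Q\<close> is an isotropic quadratic, completing the square turns this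
  expression into \<open>(t/2) \<parallel>x + h/t\<parallel>\<^sup>2\<close> plus a constant. Hence, among points of any set, the objective
  exceeds \<open>t\<close> exactly at those closer to \<open>-h/t\<close> than a point that attains \<open>t\<close>; if \<open>t\<close> is attained at a
  projection of \<open>-h/t\<close>, then the maximizers are exactly the projections of \<open>-h/t\<close>
  (lemma \<open>solutions_eq_orth_proj\<close>).

  Positivity of the supremum gives \<open>\<gamma> < \<xi> \<parallel>h\<parallel>\<close>, which makes \<open>e\<close>, the larger root of
  \<open>Q\<^sub>0 t\<^sup>2 + \<gamma> t - \<parallel>h\<parallel>\<^sup>2/2\<close>, positive. For \<open>t = e\<close> the constant left over from completing the square
  is zero, so \<open>e\<close> is the maximum over the whole space, attained at \<open>-h/e\<close>. If that point lies in the
  ball, it is its own projection and is optimal. Otherwise let \<open>t\<close> be the value at \<open>-(\<xi>/\<parallel>h\<parallel>) h\<close>; it is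
  positive and at most \<open>e\<close>, so \<open>-h/t\<close> is at least as far out as \<open>-h/e\<close>, and its projection onto the
  ball is the point \<open>-(\<xi>/\<parallel>h\<parallel>) h\<close> itself.
\<close>

lemma orth_proj_iff:
  "x \<in> orth_proj C y \<longleftrightarrow> x \<in> C \<and> (\<forall>z\<in>C. norm (x - y) \<le> norm (z - y))"
proof -
  have "1/2 * (norm (z - y))\<^sup>2 < 1/2 * (norm (x - y))\<^sup>2 \<longleftrightarrow> norm (z - y) < norm (x - y)" for z
    by (simp add: abs_le_square_iff flip: not_le)
  then show ?thesis
    by (auto simp: orth_proj_def is_arg_min_def not_less)
qed

text \<open>The variational inequality makes the angle at \<open>p\<close> in the triangle \<open>x, p, y\<close> non-acute, so
  \<open>\<parallel>x - y\<parallel>\<^sup>2 \<ge> \<parallel>x - p\<parallel>\<^sup>2 + \<parallel>p - y\<parallel>\<^sup>2\<close>, and \<open>p\<close> is the strict minimizer.\<close>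

lemma orth_proj_eq_singletonI:
  assumes "p \<in> C" and obtuse: "\<And>x. x \<in> C \<Longrightarrow> (x - p) \<bullet> (y - p) \<le> 0"
  shows "orth_proj C y = {p}"
proof -
  have pyth: "(norm (x - y))\<^sup>2 \<ge> (norm (x - p))\<^sup>2 + (norm (p - y))\<^sup>2" if "x \<in> C" for x
    using obtuse[OF that]
    by (simp add: power2_norm_eq_inner inner_diff inner_commute)
  have le: "norm (p - y) \<le> norm (x - y)" if "x \<in> C" for x
  proof (rule power2_le_imp_le)
    show "(norm (p - y))\<^sup>2 \<le> (norm (x - y))\<^sup>2"
      using pyth[OF that] zero_le_power2[of "norm (x - p)"] by linarith
  qed simp
  have uniq: "x = p" if "x \<in> C" "norm (x - y) \<le> norm (p - y)" for x
  proof -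
    have "(norm (x - y))\<^sup>2 \<le> (norm (p - y))\<^sup>2"
      using that(2) by (intro power_mono) auto
    then have "(norm (x - p))\<^sup>2 \<le> 0"
      using pyth[OF that(1)] by linarith
    then show ?thesis by simp
  qed
  show ?thesis
    using \<open>p \<in> C\<close> le uniq by (auto simp: orth_proj_iff)
qed

lemma orth_proj_ball:
  fixes y :: "real ^ 'n"
  assumes "\<xi> > 0"
  shows "orth_proj {x. norm x \<le> \<xi>} y = {if norm y > \<xi> then (\<xi> / norm y) *\<^sub>R y else y}"
proof (cases "norm y > \<xi>")
  case True
  let ?p = "(\<xi> / norm y) *\<^sub>R y"
  have y: "norm y > 0" using True assms by linarith
  have "orth_proj {x. norm x \<le> \<xi>} y = {?p}"
  proof (rule orth_proj_eq_singletonI)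
    show "?p \<in> {x. norm x \<le> \<xi>}" using assms y by simp
  next
    fix x :: "real ^ 'n" assume "x \<in> {x. norm x \<le> \<xi>}"
    then have "x \<bullet> y \<le> \<xi> * norm y"
      using norm_cauchy_schwarz[of x y] mult_right_mono[of "norm x" \<xi> "norm y"] by simp
    moreover have "?p \<bullet> y = \<xi> * norm y"
      using y by (simp add: power2_eq_square flip: power2_norm_eq_inner)
    ultimately have "(x - ?p) \<bullet> y \<le> 0" by (simp add: inner_diff_left)
    moreover have "y - ?p = (1 - \<xi> / norm y) *\<^sub>R y" by (simp add: scaleR_diff_left)
    moreover have "1 - \<xi> / norm y \<ge> 0" using True y by simp
    ultimately show "(x - ?p) \<bullet> (y - ?p) \<le> 0"
      by (metis inner_scaleR_right mult_nonneg_nonpos)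
  qed
  then show ?thesis using True by simp
next
  case False
  then show ?thesis by (auto intro!: orth_proj_eq_singletonI)
qed

lemma quad_pos: "Q\<^sub>0 > 0 \<Longrightarrow> quad Q\<^sub>0 x > 0"
  by (simp add: quad_def add_nonneg_pos)

lemma obj_completed_square:
  fixes h :: "real ^ 'n"
  assumes "Q\<^sub>0 > 0" "t \<noteq> 0"
  shows "obj Q\<^sub>0 \<gamma> h x
    = t - (t/2 * (norm (x - - (inverse t *\<^sub>R h)))\<^sup>2 + (t * Q\<^sub>0 + \<gamma> - (norm h)\<^sup>2 / (2 * t))) / quad Q\<^sub>0 x"
proof -
  have "t/2 * (norm (x - - (inverse t *\<^sub>R h)))\<^sup>2
      = t/2 * (norm x)\<^sup>2 + h \<bullet> x + (norm h)\<^sup>2 / (2 * t)"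
    using assms(2) unfolding power2_norm_eq_inner
    by (simp add: inner_add inner_commute field_simps)
  then have "t/2 * (norm (x - - (inverse t *\<^sub>R h)))\<^sup>2 + (t * Q\<^sub>0 + \<gamma> - (norm h)\<^sup>2 / (2 * t))
      = t * quad Q\<^sub>0 x + (\<gamma> + h \<bullet> x)"
    by (simp add: quad_def algebra_simps)
  moreover have "obj Q\<^sub>0 \<gamma> h x = t - (t * quad Q\<^sub>0 x + (\<gamma> + h \<bullet> x)) / quad Q\<^sub>0 x"
    using quad_pos[OF assms(1), of x] by (simp add: obj_def add_divide_distrib)
  ultimately show ?thesis by (simp only:)
qed

text \<open>The constant in the completed square does not depend on the point, and a point \<open>u\<close> that attains
  the value \<open>t\<close> determines it; what remains is a difference of two squared distances.\<close>

lemma obj_eq_distance_gap: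
  fixes h :: "real ^ 'n"
  assumes "Q\<^sub>0 > 0" "t \<noteq> 0" and u: "obj Q\<^sub>0 \<gamma> h u = t"
  defines "y \<equiv> - (inverse t *\<^sub>R h)"
  shows "obj Q\<^sub>0 \<gamma> h x = t + t/2 * ((norm (u - y))\<^sup>2 - (norm (x - y))\<^sup>2) / quad Q\<^sub>0 x"
proof -
  define c where "c = t * Q\<^sub>0 + \<gamma> - (norm h)\<^sup>2 / (2 * t)"
  have sq: "obj Q\<^sub>0 \<gamma> h z = t - (t/2 * (norm (z - y))\<^sup>2 + c) / quad Q\<^sub>0 z" for z
    using obj_completed_square[OF assms(1,2)] by (simp only: y_def c_def)
  have c: "c = - (t/2 * (norm (u - y))\<^sup>2)"
    using sq[of u] u quad_pos[OF assms(1), of u] by simp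
  show ?thesis
    unfolding sq[of x] c by (simp add: diff_divide_distrib right_diff_distrib)
qed

text \<open>By the distance gap, a point has a value above, equal to or below \<open>t\<close> according to whether it is
  closer to \<open>-h/t\<close> than \<open>u\<close>, equally close, or farther. Since no point of \<open>C\<close> is closer than \<open>u\<close>,
  \<open>t\<close> is the optimal value, and it is attained precisely at the minimal distance.\<close>

lemma solutions_eq_orth_proj:
  fixes h :: "real ^ 'n"
  assumes "Q\<^sub>0 > 0" "t > 0" and u: "obj Q\<^sub>0 \<gamma> h u = t"
    and proj: "u \<in> orth_proj C (- (inverse t *\<^sub>R h))"
  shows "solutions (obj Q\<^sub>0 \<gamma> h) C = orth_proj C (- (inverse t *\<^sub>R h))"
proof -
  define y where "y = - (inverse t *\<^sub>R h)"
  have gap: "obj Q\<^sub>0 \<gamma> h x = t + t/2 * ((norm (u - y))\<^sup>2 - (norm (x - y))\<^sup>2) / quad Q\<^sub>0 x" for x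
    unfolding y_def using assms by (intro obj_eq_distance_gap) auto
  have pos: "t/2 > 0" "quad Q\<^sub>0 x > 0" for x
    using assms quad_pos by auto
  have le: "obj Q\<^sub>0 \<gamma> h x \<le> t \<longleftrightarrow> norm (u - y) \<le> norm (x - y)" for x
    using pos pos(2)[of x]
    by (simp add: gap divide_le_0_iff mult_le_0_iff abs_le_square_iff[symmetric])
  have eq: "obj Q\<^sub>0 \<gamma> h x = t \<longleftrightarrow> norm (x - y) = norm (u - y)" for x
    using pos(1) pos(2)[of x] by (auto simp: gap)
  have uC: "u \<in> C" and closest: "\<And>z. z \<in> C \<Longrightarrow> norm (u - y) \<le> norm (z - y)"
    using proj by (auto simp: orth_proj_iff y_def)
  have max: "obj Q\<^sub>0 \<gamma> h z \<le> t" if "z \<in> C" for z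
    using le closest[OF that] by blast
  have "x \<in> solutions (obj Q\<^sub>0 \<gamma> h) C \<longleftrightarrow> x \<in> C \<and> obj Q\<^sub>0 \<gamma> h x = t" for x
    using max uC u unfolding solutions_def is_arg_max_def
    by (auto simp: not_less order.antisym)
  moreover have "x \<in> orth_proj C y \<longleftrightarrow> x \<in> C \<and> norm (x - y) = norm (u - y)" for x
    using uC closest by (auto simp: orth_proj_iff order.antisym)
  ultimately show ?thesis
    using eq by (auto simp: y_def)
qed

text \<open>At a root \<open>t\<close> the constant in the completed square is zero, so the objective falls short of \<open>t\<close>
  by \<open>t / (2 Q(x))\<close> times the squared distance from \<open>x\<close> to \<open>-h/t\<close>.\<close>

lemma obj_at_root:
  fixes h :: "real ^ 'n"
  assumes "Q\<^sub>0 > 0" "t > 0" and root: "Q\<^sub>0 * t\<^sup>2 + \<gamma> * t = (norm h)\<^sup>2 / 2"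
  shows "obj Q\<^sub>0 \<gamma> h (- (inverse t *\<^sub>R h)) = t" and "obj Q\<^sub>0 \<gamma> h x \<le> t"
proof -
  have "t * Q\<^sub>0 + \<gamma> - (norm h)\<^sup>2 / (2 * t) = 0"
    using root assms(2) by (simp add: field_simps power2_eq_square)
  then have sq: "obj Q\<^sub>0 \<gamma> h z = t - t/2 * (norm (z - - (inverse t *\<^sub>R h)))\<^sup>2 / quad Q\<^sub>0 z" for z
    using obj_completed_square[OF assms(1), of t \<gamma> h z] assms(2) by simp
  show "obj Q\<^sub>0 \<gamma> h (- (inverse t *\<^sub>R h)) = t"
    by (simp add: sq)
  have "t/2 * (norm (x - - (inverse t *\<^sub>R h)))\<^sup>2 / quad Q\<^sub>0 x \<ge> 0"
    using assms(2) less_imp_le[OF quad_pos[OF assms(1), of x]]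
    by (intro divide_nonneg_nonneg mult_nonneg_nonneg) auto
  then show "obj Q\<^sub>0 \<gamma> h x \<le> t"
    by (simp only: sq)
qed

lemma obj_pos_imp_less:
  fixes h :: "real ^ 'n"
  assumes "Q\<^sub>0 > 0" "norm x \<le> \<xi>" "obj Q\<^sub>0 \<gamma> h x > 0"
  shows "\<gamma> < \<xi> * norm h"
proof -
  have "\<gamma> + h \<bullet> x < 0"
    using assms(3) quad_pos[OF assms(1), of x] by (simp add: obj_def divide_less_0_iff)
  moreover have "- (h \<bullet> x) \<le> norm h * norm x"
    using Cauchy_Schwarz_ineq2[of h x] by linarith
  moreover have "norm h * norm x \<le> \<xi> * norm h"
    using assms(2) using mult_right_mono[of "norm x" \<xi> "norm h"] by (simp add: mult.commute)
  ultimately show ?thesis by linarith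
qed

lemma obj_at_boundary:
  fixes h :: "real ^ 'n"
  assumes "h \<noteq> 0" "\<xi> > 0"
  shows "obj Q\<^sub>0 \<gamma> h (- ((\<xi> / norm h) *\<^sub>R h)) = - (2 * (\<gamma> - \<xi> * norm h) / (\<xi>\<^sup>2 + 2 * Q\<^sub>0))"
proof -
  have "h \<bullet> (- ((\<xi> / norm h) *\<^sub>R h)) = - (\<xi> * norm h)"
    using assms by (simp add: power2_eq_square flip: power2_norm_eq_inner)
  moreover have "quad Q\<^sub>0 (- ((\<xi> / norm h) *\<^sub>R h)) = (\<xi>\<^sup>2 + 2 * Q\<^sub>0) / 2"
    using assms by (simp add: quad_def field_simps)
  ultimately have "obj Q\<^sub>0 \<gamma> h (- ((\<xi> / norm h) *\<^sub>R h))
      = - ((\<gamma> + - (\<xi> * norm h)) / ((\<xi>\<^sup>2 + 2 * Q\<^sub>0) / 2))"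
    by (simp only: obj_def)
  then show ?thesis by (simp add: mult.commute)
qed

text \<open>If \<open>k > 0\<close>, the two roots have a negative product and \<open>e\<close> is the positive one. If \<open>k = 0\<close>, then
  \<open>\<gamma> < 0\<close> and the roots are \<open>0\<close> and \<open>-\<gamma>/q\<close>. The parameter \<open>k\<close> stands for \<open>\<parallel>h\<parallel>\<^sup>2\<close>.\<close>

lemma larger_root:
  fixes q \<gamma> k :: real
  assumes "q > 0" "k \<ge> 0" "\<gamma> < 0 \<or> k > 0"
  defines "e \<equiv> (- \<gamma> + sqrt (\<gamma>\<^sup>2 + 2 * q * k)) / (2 * q)"
  shows "e > 0" and "q * e\<^sup>2 + \<gamma> * e = k / 2"
proof -
  define s where "s = sqrt (\<gamma>\<^sup>2 + 2 * q * k)"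
  have s2: "s\<^sup>2 = \<gamma>\<^sup>2 + 2 * q * k" and s0: "s \<ge> 0"
    using assms by (simp_all add: s_def)
  have "\<gamma> < s"
  proof (cases "\<gamma> < 0")
    case True
    then show ?thesis using s0 by linarith
  next
    case False
    then have "\<gamma>\<^sup>2 < s\<^sup>2" using s2 assms by simp
    then show ?thesis using s0 by (rule power2_less_imp_less)
  qed
  then show "e > 0" using assms(1) by (simp add: e_def s_def)
  have s_eq: "s = 2 * q * e + \<gamma>"
    using assms(1) by (simp add: e_def s_def)
  have "(2 * q * e + \<gamma>)\<^sup>2 = \<gamma>\<^sup>2 + 2 * q * k"
    using s2 by (simp only: s_eq)
  then have "(4 * q) * (q * e\<^sup>2 + \<gamma> * e) = (4 * q) * (k / 2)"
    by (simp add: power2_eq_square algebra_simps)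
  then show "q * e\<^sup>2 + \<gamma> * e = k / 2"
    using assms(1) by simp
qed

theorem proposition3p5:
  fixes \<xi> \<gamma> Q\<^sub>0 \<beta>\<^sub>1 \<beta>\<^sub>2 \<beta>\<^sub>3 e :: real
    and h :: "real ^ 'n"
    and C :: "(real ^ 'n) set"
  assumes "\<xi> > 0"
    and "C = {x. norm x \<le> \<xi>}"
    and "Q\<^sub>0 > 0"
    and "(SUP x\<in>C. obj Q\<^sub>0 \<gamma> h x) > 0"
    and "\<beta>\<^sub>1 = Q\<^sub>0"
    and "\<beta>\<^sub>2 = \<gamma>"
    and "\<beta>\<^sub>3 = - 1/2 * (norm h)\<^sup>2"
    and "e = (- \<beta>\<^sub>2 + sqrt (\<beta>\<^sub>2\<^sup>2 - 4 * \<beta>\<^sub>1 * \<beta>\<^sub>3)) / (2 * \<beta>\<^sub>1)"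
  shows "(\<forall>y. orth_proj C y = {if norm y > \<xi> then (\<xi> / norm y) *\<^sub>R y else y}) \<and>
    (norm (inverse e *\<^sub>R h) \<le> \<xi> \<longrightarrow>
      - (inverse e *\<^sub>R h) \<in> solutions (obj Q\<^sub>0 \<gamma> h) C \<and>
      obj Q\<^sub>0 \<gamma> h (- (inverse e *\<^sub>R h)) = e) \<and>
    (\<not> norm (inverse e *\<^sub>R h) \<le> \<xi> \<longrightarrow>
      solutions (obj Q\<^sub>0 \<gamma> h) C = {- ((\<xi> / norm h) *\<^sub>R h)} \<and>
      obj Q\<^sub>0 \<gamma> h (- ((\<xi> / norm h) *\<^sub>R h)) = - (2 * (\<gamma> - \<xi> * norm h) / (\<xi>\<^sup>2 + 2 * Q\<^sub>0)))"
proof -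
  have C: "C = {x. norm x \<le> \<xi>}" by fact
  have proj: "orth_proj C y = {if norm y > \<xi> then (\<xi> / norm y) *\<^sub>R y else y}" for y
    unfolding C by (rule orth_proj_ball) fact
  have "\<exists>x\<in>C. obj Q\<^sub>0 \<gamma> h x > 0"
  proof (rule ccontr)
    assume "\<not> ?thesis"
    then have "(SUP x\<in>C. obj Q\<^sub>0 \<gamma> h x) \<le> 0"
      using \<open>\<xi> > 0\<close> by (intro cSUP_least) (auto simp: C not_less intro: exI[of _ 0])
    then show False using assms(4) by linarith
  qed
  then have \<gamma>_less: "\<gamma> < \<xi> * norm h"
    using obj_pos_imp_less[OF \<open>Q\<^sub>0 > 0\<close>] by (auto simp: C)
  have e: "e = (- \<gamma> + sqrt (\<gamma>\<^sup>2 + 2 * Q\<^sub>0 * (norm h)\<^sup>2)) / (2 * Q\<^sub>0)"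
    using assms by simp
  have "\<gamma> < 0 \<or> (norm h)\<^sup>2 > 0"
    using \<gamma>_less by (cases "h = 0") auto
  then have e_pos: "e > 0" and root: "Q\<^sub>0 * e\<^sup>2 + \<gamma> * e = (norm h)\<^sup>2 / 2"
    using larger_root[OF \<open>Q\<^sub>0 > 0\<close>, of "(norm h)\<^sup>2" \<gamma>] by (simp_all add: e)
  note at_root = obj_at_root[OF \<open>Q\<^sub>0 > 0\<close> e_pos root]

  have interior: "- (inverse e *\<^sub>R h) \<in> solutions (obj Q\<^sub>0 \<gamma> h) C"
    if "norm (inverse e *\<^sub>R h) \<le> \<xi>"
  proof -
    have "orth_proj C (- (inverse e *\<^sub>R h)) = {- (inverse e *\<^sub>R h)}"
      using that by (simp add: proj)
    then show ?thesis
      using solutions_eq_orth_proj[OF \<open>Q\<^sub>0 > 0\<close> e_pos at_root(1)] by simp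
  qed

  let ?v = "- ((\<xi> / norm h) *\<^sub>R h)"
  have boundary: "solutions (obj Q\<^sub>0 \<gamma> h) C = {?v} \<and>
      obj Q\<^sub>0 \<gamma> h ?v = - (2 * (\<gamma> - \<xi> * norm h) / (\<xi>\<^sup>2 + 2 * Q\<^sub>0))"
    if outside: "\<not> norm (inverse e *\<^sub>R h) \<le> \<xi>"
  proof -
    have h: "h \<noteq> 0" using outside \<open>\<xi> > 0\<close> by auto
    define t where "t = obj Q\<^sub>0 \<gamma> h ?v"
    have t_eq: "t = - (2 * (\<gamma> - \<xi> * norm h) / (\<xi>\<^sup>2 + 2 * Q\<^sub>0))"
      unfolding t_def using h \<open>\<xi> > 0\<close> by (rule obj_at_boundary)
    have "\<xi>\<^sup>2 + 2 * Q\<^sub>0 > 0" using \<open>Q\<^sub>0 > 0\<close> by (simp add: add_nonneg_pos)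
    then have t_pos: "t > 0"
      using \<gamma>_less by (simp add: t_eq divide_less_0_iff)
    \<comment> \<open>The candidate value cannot exceed the maximum over the whole space; this puts \<open>-h/t\<close>
      at least as far from the origin as \<open>-h/e\<close>, hence outside the ball.\<close>
    have "t \<le> e" unfolding t_def by (rule at_root(2))
    then have "inverse e * norm h \<le> inverse t * norm h"
      using t_pos by (intro mult_right_mono le_imp_inverse_le) auto
    then have far: "norm (- (inverse t *\<^sub>R h)) > \<xi>"
      using outside e_pos t_pos by simp
    have "(\<xi> / norm (- (inverse t *\<^sub>R h))) *\<^sub>R (- (inverse t *\<^sub>R h)) = ?v"
      using t_pos by simp
    then have "orth_proj C (- (inverse t *\<^sub>R h)) = {?v}"
      using far unfolding proj by simp
    then show ?thesis
      using solutions_eq_orth_proj[OF \<open>Q\<^sub>0 > 0\<close> t_pos t_def[symmetric], of C] t_eq t_def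
      by simp
  qed

  show ?thesis
    using proj interior at_root(1) boundary by blast
qed

end
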